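(* For any Dyck path $d$ of semilength $n$, the valley-swapping procedure described in the context terminates with a canon permutation of the form $\mathrm{can}(d,\tau)$, and the resulting permutation $\mathrm{vperm}(d)=\tau$ lies in $M_d$.
   Context: A Dyck path of semilength $n$ is a lattice path from $(0,0)$ to $(2n,0)$ with steps $U=(1,1)$ and $D=(1,-1)$ never going below the $x$-axis. For $\sigma=\sigma_1\cdots\sigma_n\in\mathfrak{S}_n$, $\mathrm{can}(d,\sigma)$ is the word of length $2n$ obtained by labeling the $i$-th up-step and the $i$-th down-step of $d$ with $\sigma_i$ and reading left to right; $\mathrm{des}(d,\sigma)$ is the number of $j\in[2n-1]$ with $\mathrm{can}(d,\sigma)_j>\mathrm{can}(d,\sigma)_{j+1}$; $m_d=\max_\sigma \mathrm{des}(d,\sigma)$ and $M_d=\{\sigma\in\mathfrak{S}_n\mid \mathrm{des}(d,\sigma)=m_d\}$. The bounce path of $d$: start at $(0,0)$, take up-steps until reaching a point of $d$ where $d$'s next step is a down-step, then take down-steps to the $x$-axis, then up-steps until again meeting a down-step of $d$, and so on until $(2n,0)$. For Dyck paths $d_1,d_2$ of the same semilength, $d_1$ is under $d_2$ if $d_1$ lies weakly below $d_2$. A valley is an occurrence of $DU$. Valley swap: given $\mathrm{can}(e,\sigma)$ and a valley of $e$ whose two steps carry labels $i$ and $j$ with $i<j$, the valley swap produces $\mathrm{can}(e',\sigma')$ where $e'$ is obtained from $e$ by replacing this $DU$ by $UD$, and $\sigma'$ is obtained from $\sigma$ by replacing the entry $i$ by $j$ and each entry $k\in\{i+1,\ldots,j\}$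 by $k-1$. Procedure: let $\delta_n=n(n-1)\cdots 1$ and start with $c=\mathrm{can}(\mathrm{bounce}(d),\delta_n)$. While the underlying Dyck path of $c$ is not $d$: find the leftmost valley of the underlying path of $c$ such that turning it into a peak yields a Dyck path under $d$, and replace $c$ by the result of the valley swap at that valley. *)

theory Defs
  imports
    "HOL-Library.While_Combinator"
    "HOL-Combinatorics.Multiset_Permutations"
begin

datatype lstep = U | D

(* ordinate of the lattice path d at abscissa k *)
definition height :: "lstep list \<Rightarrow> nat \<Rightarrow> int" where
  "height d k = int (count_list (take k d) U) - int (count_list (take k d) D)"

definition dyck_path :: "nat \<Rightarrow> lstep list \<Rightarrow> bool" where
  "dyck_path n d \<longleftrightarrow>
     length d = 2 * n \<and> (\<forall>k\<le>2 * n. 0 \<le> height d k) \<and> height d (2 * n) = 0"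

definition under :: "lstep list \<Rightarrow> lstep list \<Rightarrow> bool" where
  "under d1 d2 \<longleftrightarrow> length d1 = length d2 \<and> (\<forall>k\<le>length d1. height d1 k \<le> height d2 k)"

(* Permutations are in one-line notation, as elements of permutations_of_set {1..n}. The step at
   (0-based) position k, preceded by i steps of its own kind, is the (i+1)-st of its kind and gets
   the label sigma_{i+1}, which is sigma ! i. *)
definition can :: "lstep list \<Rightarrow> nat list \<Rightarrow> nat list" where
  "can d \<sigma> = map (\<lambda>k. \<sigma> ! count_list (take k d) (d ! k)) [0..<length d]"

definition des :: "lstep list \<Rightarrow> nat list \<Rightarrow> nat" where
  "des d \<sigma> = card {j. Suc j < length (can d \<sigma>) \<and> can d \<sigma> ! j > can d \<sigma> ! Suc j}"

definition max_des :: "nat \<Rightarrow> lstep list \<Rightarrow> nat" where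
  "max_des n d = Max (des d ` permutations_of_set {1..n})"

definition max_des_perms :: "nat \<Rightarrow> lstep list \<Rightarrow> nat list set" where
  "max_des_perms n d = {\<sigma> \<in> permutations_of_set {1..n}. des d \<sigma> = max_des n d}"

(* Starting at (x,0), u up-steps lead to a point of d at which the next step of d is a down-step.
   For a Dyck path the other conditions already exclude u = 0. *)
definition bounce_hit :: "lstep list \<Rightarrow> nat \<Rightarrow> nat \<Rightarrow> bool" where
  "bounce_hit d x u \<longleftrightarrow>
     0 < u \<and> x + u < length d \<and> height d (x + u) = int u \<and> d ! (x + u) = D"

(* the part of the bounce path of d that starts at (x,0) *)
function bounce_from :: "lstep list \<Rightarrow> nat \<Rightarrow> lstep list" where
  "bounce_from d x =
     (if \<exists>u. bounce_hit d x u
      then let u = (LEAST u. bounce_hit d x u)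
           in replicate u U @ replicate u D @ bounce_from d (x + 2 * u)
      else [])"
  by pat_completeness auto
termination
proof (relation "measure (\<lambda>(d, x). length d - x)", simp, goal_cases)
  case (1 d x u)
  then have "bounce_hit d x u" by (metis LeastI)
  then show ?case by (auto simp: bounce_hit_def)
qed

declare bounce_from.simps [simp del]

definition bounce :: "lstep list \<Rightarrow> lstep list" where
  "bounce d = bounce_from d 0"

definition valley :: "lstep list \<Rightarrow> nat \<Rightarrow> bool" where
  "valley e p \<longleftrightarrow> Suc p < length e \<and> e ! p = D \<and> e ! Suc p = U"

definition to_peak :: "lstep list \<Rightarrow> nat \<Rightarrow> lstep list" where
  "to_peak e p = e[p := U, Suc p := D]"

definition relabel :: "nat \<Rightarrow> nat \<Rightarrow> nat \<Rightarrow> nat" where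
  "relabel i j k = (if k = i then j else if i < k \<and> k \<le> j then k - 1 else k)"

(* A canon permutation can e sigma is represented by the pair (e, sigma), which it determines; see
   can_inject below. *)
type_synonym canon = "lstep list \<times> nat list"

(* i < j are the labels of the two steps of the valley, whichever of the two steps carries the
   smaller one. They are never equal: in a Dyck path the down-step and the up-step of a valley have
   different ranks among the steps of their kind. *)
definition valley_swap :: "canon \<Rightarrow> nat \<Rightarrow> canon" where
  "valley_swap c p =
     (case c of (e, \<sigma>) \<Rightarrow>
        let a = can e \<sigma> ! p; b = can e \<sigma> ! Suc p; i = min a b; j = max a b
        in (to_peak e p, map (relabel i j) \<sigma>))"

definition swappable :: "nat \<Rightarrow> lstep list \<Rightarrow> lstep list \<Rightarrow> nat \<Rightarrow> bool" where
  "swappable n d e p \<longleftrightarrow>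
     valley e p \<and> dyck_path n (to_peak e p) \<and> under (to_peak e p) d"

(* None: there is no valley to swap, and the procedure is stuck *)
definition swap_leftmost :: "nat \<Rightarrow> lstep list \<Rightarrow> canon \<Rightarrow> canon option" where
  "swap_leftmost n d c =
     (if \<exists>p. swappable n d (fst c) p
      then Some (valley_swap c (LEAST p. swappable n d (fst c) p))
      else None)"

definition decreasing_perm :: "nat \<Rightarrow> nat list" where
  "decreasing_perm n = rev [1..<Suc n]"

(* The outer option is that of while_option: None if the loop runs forever. The inner one is None
   if the loop was aborted because it got stuck. *)
definition valley_procedure :: "nat \<Rightarrow> lstep list \<Rightarrow> canon option option" where
  "valley_procedure n d =
     while_option
       (\<lambda>s. case s of None \<Rightarrow> False | Some c \<Rightarrow> fst c \<noteq> d)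
       (\<lambda>s. Option.bind s (swap_leftmost n d))
       (Some (bounce d, decreasing_perm n))"

definition vperm :: "nat \<Rightarrow> lstep list \<Rightarrow> nat list" where
  "vperm n d = snd (the (the (valley_procedure n d)))"


lemma length_can [simp]: "length (can d \<sigma>) = length d"
  by (simp add: can_def)

lemma can_nth: "k < length d \<Longrightarrow> can d \<sigma> ! k = \<sigma> ! count_list (take k d) (d ! k)"
  by (simp add: can_def)

lemma count_list_take_Suc:
  "k < length d \<Longrightarrow>
     count_list (take (Suc k) d) s = count_list (take k d) s + (if d ! k = s then 1 else 0)"
  by (simp add: take_Suc_conv_app_nth)

lemma count_list_take_mono:
  assumes "j \<le> k" shows "count_list (take j d) s \<le> count_list (take k d) s"
proof -
  have "take k d = take j d @ take (k - j) (drop j d)"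
    using assms by (metis le_add_diff_inverse take_add)
  then show ?thesis by simp
qed

lemma ex_step_of_rank:
  assumes "k \<le> length d" "v < count_list (take k d) s"
  shows "\<exists>j<k. d ! j = s \<and> count_list (take j d) s = v"
  using assms
proof (induction k)
  case (Suc k)
  then have k: "k < length d" by simp
  show ?case
  proof (cases "v < count_list (take k d) s")
    case True
    then show ?thesis using Suc.IH k by (meson less_SucI less_imp_le_nat)
  next
    case False
    then have "d ! k = s" "v = count_list (take k d) s"
      using Suc.prems k by (auto simp: count_list_take_Suc split: if_splits)
    then show ?thesis by blast
  qed
qed simp

lemma dyck_path_counts:
  assumes "dyck_path n d"
  shows "k \<le> 2 * n \<Longrightarrow> count_list (take k d) D \<le> count_list (take k d) U"
    and "count_list d U = n"
proof -
  show "count_list (take k d) D \<le> count_list (take k d) U" if "k \<le> 2 * n"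
    using assms that by (force simp: dyck_path_def height_def)
  have "count_list xs U + count_list xs D = length xs" for xs
    by (induction xs) (use lstep.exhaust in auto)
  from this[of d] show "count_list d U = n"
    using assms by (auto simp: dyck_path_def height_def)
qed

lemma dyck_step_iff:
  assumes d: "dyck_path n d" and \<sigma>: "\<sigma> \<in> permutations_of_set {1..n}" and k: "k < 2 * n"
  shows "d ! k = U \<longleftrightarrow> can d \<sigma> ! k \<notin> set (take k (can d \<sigma>))"
proof -
  have len: "length d = 2 * n" using d by (simp add: dyck_path_def)
  have dist: "distinct \<sigma>" and len\<sigma>: "length \<sigma> = n"
    using \<sigma> by (auto simp: permutations_of_set_def dest: distinct_card)
  have mem: "x \<in> set (take k (can d \<sigma>)) \<longleftrightarrow> (\<exists>j<k. can d \<sigma> ! j = x)" for x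
    using k len by (auto simp: in_set_conv_nth)
  show ?thesis
  proof (cases "d ! k")
    case U
    let ?u = "count_list (take k d) U"
    have "count_list (take (Suc k) d) U \<le> count_list (take (2 * n) d) U"
      using k by (intro count_list_take_mono) simp
    then have u: "?u < n"
      using U k len dyck_path_counts(2)[OF d] by (simp add: count_list_take_Suc)
    have "can d \<sigma> ! j \<noteq> can d \<sigma> ! k" if j: "j < k" for j
    proof -
      have "count_list (take (Suc j) d) (d ! j) \<le> count_list (take (Suc j) d) U"
        using dyck_path_counts(1)[OF d, of "Suc j"] j k by (cases "d ! j") auto
      also have "\<dots> \<le> ?u" using j by (intro count_list_take_mono) simp
      finally have "count_list (take j d) (d ! j) < ?u"
        using j k len by (simp add: count_list_take_Suc)
      then show ?thesis
        using j k len U u dist len\<sigma> by (simp add: can_nth nth_eq_iff_index_eq)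
    qed
    then show ?thesis using U mem by simp
  next
    case D
    have "count_list (take k d) D < count_list (take k d) U"
      using dyck_path_counts(1)[OF d, of "Suc k"] k len D by (simp add: count_list_take_Suc)
    from ex_step_of_rank[OF _ this] obtain j
      where "j < k" "d ! j = U" "count_list (take j d) U = count_list (take k d) D"
      using k len by auto
    then have "can d \<sigma> ! j = can d \<sigma> ! k" using D k len by (simp add: can_nth)
    then show ?thesis using D mem \<open>j < k\<close> by auto
  qed
qed

lemma can_inject:
  assumes d: "dyck_path n d" "\<sigma> \<in> permutations_of_set {1..n}"
    and e: "dyck_path n e" "\<tau> \<in> permutations_of_set {1..n}"
    and eq: "can d \<sigma> = can e \<tau>"
  shows "d = e \<and> \<sigma> = \<tau>"
proof
  have len: "length d = 2 * n" "length e = 2 * n" using d e by (auto simp: dyck_path_def)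
  show de: "d = e"
  proof (rule nth_equalityI)
    fix k assume "k < length d"
    then have "d ! k = U \<longleftrightarrow> e ! k = U"
      using dyck_step_iff[OF d, of k] dyck_step_iff[OF e, of k] eq len by simp
    then show "d ! k = e ! k" by (metis lstep.exhaust)
  qed (use len in simp)
  have len\<sigma>: "length \<sigma> = n" "length \<tau> = n"
    using d e by (auto simp: permutations_of_set_def dest: distinct_card)
  show "\<sigma> = \<tau>"
  proof (rule nth_equalityI)
    fix i assume "i < length \<sigma>"
    then have "i < count_list (take (2 * n) d) U"
      using dyck_path_counts(2)[OF d(1)] len len\<sigma> by simp
    from ex_step_of_rank[OF _ this] obtain j
      where "j < 2 * n" "d ! j = U" "count_list (take j d) U = i"
      using len by auto
    then show "\<sigma> ! i = \<tau> ! i"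
      using arg_cong[OF eq, of "\<lambda>w. w ! j"] len de by (simp add: can_nth)
  qed (use len\<sigma> in simp)
qed

end

theory Submission
  imports Defs
begin

text \<open>
  Say that the step with \<open>k\<close> predecessors of its own kind has rank \<open>k\<close>. If \<open>r\<close> is the rank of the
  first up-step of a bounce, then the up-step and the down-step of \<open>d\<close> of rank \<open>r\<close> carry the same
  label, so a non-descent occurs between them; these stretches of \<open>d\<close> are disjoint, hence every
  labelling has at least as many non-descents as there are bounces. Conversely, the procedure moves
  the up-steps, in order, to their places in \<open>d\<close>, and each swap lifts the label of the moved
  up-step to just above that of the down-step it passes. This keeps the labels decreasing along
  each bounce, and in the end every step is a descent except possibly the one into the
  down-step of rank \<open>r\<close>, for each such \<open>r\<close>.
\<close>

section \<open>Down-steps preceding an up-step\<close>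

text \<open>A path is encoded by this function of the rank of an up-step: a valley swap becomes a
  decrement at one argument, and \<open>under\<close> a pointwise inequality. Beyond the last rank
  all down-steps are counted.\<close>

fun dbefore :: "lstep list \<Rightarrow> nat \<Rightarrow> nat" where
  "dbefore [] w = 0"
| "dbefore (D # e) w = Suc (dbefore e w)"
| "dbefore (U # e) 0 = 0"
| "dbefore (U # e) (Suc w) = dbefore e w"

lemma count_list_U_D: "count_list xs U + count_list xs D = length xs"
  by (induction xs) (use lstep.exhaust in auto)

lemma count_list_take_U_D:
  "k \<le> length e \<Longrightarrow> count_list (take k e) U + count_list (take k e) D = k"
  by (simp add: count_list_U_D)

lemma dbefore_append:
  "dbefore (xs @ ys) w =
     (if w < count_list xs U then dbefore xs w
      else count_list xs D + dbefore ys (w - count_list xs U))"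
  by (induction xs w rule: dbefore.induct) auto

lemma count_list_replicate: "count_list (replicate a x) y = (if x = y then a else 0)"
  by (induction a) auto

lemma dbefore_replicate_U: "w < a \<Longrightarrow> dbefore (replicate a U) w = 0"
proof (induction a arbitrary: w)
  case (Suc a)
  then show ?case by (cases w) auto
qed simp

lemma dbefore_nth:
  assumes "w < count_list e U"
  shows "dbefore e w + w < length e" "e ! (dbefore e w + w) = U"
    "count_list (take (dbefore e w + w) e) U = w"
    "count_list (take (dbefore e w + w) e) D = dbefore e w"
  using assms by (induction e w rule: dbefore.induct) auto

lemma dbefore_count_take:
  "p < length e \<Longrightarrow> e ! p = U \<Longrightarrow>
     dbefore e (count_list (take p e) U) = count_list (take p e) D"
proof (induction e arbitrary: p)
  case (Cons x e)
  then show ?case by (cases x; cases p) auto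
qed simp

lemma count_list_take_less:
  assumes "i < j" "i < length e" "e ! i = s"
  shows "count_list (take i e) s < count_list (take j e) s"
proof -
  have "count_list (take (Suc i) e) s \<le> count_list (take j e) s"
    using assms by (intro count_list_take_mono) simp
  then show ?thesis using assms by (simp add: count_list_take_Suc)
qed

text \<open>Both sides say that the up-step of rank \<open>w\<close>, whose position is
  \<open>dbefore e w + w\<close>, is among the first \<open>k\<close> steps.\<close>

lemma dbefore_less_iff:
  assumes "w < count_list e U"
  shows "dbefore e w + w < k \<longleftrightarrow> w < count_list (take k e) U"
proof
  assume "dbefore e w + w < k"
  from count_list_take_less[OF this dbefore_nth(1,2)[OF assms]]
  show "w < count_list (take k e) U" using dbefore_nth(3)[OF assms] by simp
next
  assume *: "w < count_list (take k e) U"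
  show "dbefore e w + w < k"
  proof (rule ccontr)
    assume "\<not> ?thesis"
    then have "count_list (take k e) U \<le> count_list (take (dbefore e w + w) e) U"
      by (intro count_list_take_mono) simp
    then show False using * dbefore_nth(3)[OF assms] by simp
  qed
qed

lemma dbefore_mono:
  assumes "w \<le> w'" "w' < count_list e U"
  shows "dbefore e w \<le> dbefore e w'"
proof (cases "w = w'")
  case False
  then have "w < w'" using assms by simp
  then have w: "w < count_list e U" using assms by simp
  have "dbefore e w + w < dbefore e w' + w'"
    using dbefore_less_iff[OF w] dbefore_nth(3)[OF assms(2)] \<open>w < w'\<close> by simp
  then have "count_list (take (dbefore e w + w) e) D \<le> count_list (take (dbefore e w' + w') e) D"
    by (intro count_list_take_mono) simp
  then show ?thesis using dbefore_nth(4)[OF w] dbefore_nth(4)[OF assms(2)] by simp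
qed simp

lemma height_eq: "k \<le> length e \<Longrightarrow> height e k = 2 * int (count_list (take k e) U) - int k"
  using count_list_take_U_D[of k e] by (simp add: height_def)

text \<open>The height at a given abscissa is determined by the number of up-steps so far, so the
  lower path makes each up-step later.\<close>

lemma under_iff_dbefore:
  assumes "length e = length d" "count_list e U = n" "count_list d U = n"
  shows "under e d \<longleftrightarrow> (\<forall>w<n. dbefore d w \<le> dbefore e w)"
proof -
  have "under e d \<longleftrightarrow> (\<forall>k\<le>length d. count_list (take k e) U \<le> count_list (take k d) U)"
    using assms(1) by (auto simp: under_def height_eq)
  also have "\<dots> \<longleftrightarrow> (\<forall>w<n. dbefore d w \<le> dbefore e w)"
  proof (intro iffI allI impI)
    fix w
    assume le: "\<forall>k\<le>length d. count_list (take k e) U \<le> count_list (take k d) U" and w: "w < n"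
    let ?k = "Suc (dbefore e w + w)"
    have "w < count_list (take ?k e) U"
      using dbefore_less_iff[of w e ?k] w assms by simp
    moreover have "?k \<le> length d" using dbefore_nth(1)[of w e] w assms by simp
    ultimately have "w < count_list (take ?k d) U" using le by (meson less_le_trans)
    then have "dbefore d w + w < ?k" using dbefore_less_iff[of w d ?k] w assms by simp
    then show "dbefore d w \<le> dbefore e w" by simp
  next
    fix k
    assume le: "\<forall>w<n. dbefore d w \<le> dbefore e w" and "k \<le> length d"
    show "count_list (take k e) U \<le> count_list (take k d) U"
    proof (rule ccontr)
      assume "\<not> ?thesis"
      then obtain w where w: "w = count_list (take k d) U" "w < count_list (take k e) U"
        by simp
      have "count_list (take k e) U \<le> count_list (take (max k (length e)) e) U"
        by (intro count_list_take_mono) simp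
      then have "w < n" using w assms by simp
      then have "dbefore e w + w < k" using dbefore_less_iff[of w e k] w assms by simp
      then have "dbefore d w + w < k" using le \<open>w < n\<close> by fastforce
      then show False using dbefore_less_iff[of w d k] w assms \<open>w < n\<close> by simp
    qed
  qed
  finally show ?thesis .
qed

lemma under_antisym:
  assumes "under e d" "under d e"
  shows "e = d"
proof (rule nth_equalityI)
  show len: "length e = length d" using assms(1) by (simp add: under_def)
  fix k assume k: "k < length e"
  have "height e i = height d i" if "i \<le> length e" for i
    using assms that len by (auto simp: under_def intro: antisym)
  from this[of k] this[of "Suc k"] show "e ! k = d ! k"
    using k len by (cases "e ! k"; cases "d ! k") (auto simp: height_def count_list_take_Suc)
qed

text \<open>The local minima of a path are just before up-steps and at its end; before the up-step
  of rank \<open>w\<close> the height is \<open>w - dbefore e w\<close>.\<close>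

lemma dyck_pathI_dbefore:
  assumes "length e = 2 * n" "count_list e U = n" "\<And>w. w < n \<Longrightarrow> dbefore e w \<le> w"
  shows "dyck_path n e"
proof -
  have "0 \<le> height e k" if k: "k \<le> 2 * n" for k
  proof (cases "count_list (take k e) U < n")
    case True
    let ?w = "count_list (take k e) U"
    have "k \<le> dbefore e ?w + ?w" using dbefore_less_iff[of ?w e k] True assms by simp
    also have "\<dots> \<le> 2 * ?w" using assms(3)[OF True] by simp
    finally show ?thesis using k assms by (simp add: height_eq)
  next
    case False
    then show ?thesis using k assms by (simp add: height_eq)
  qed
  then show ?thesis using assms by (simp add: dyck_path_def height_eq)
qed

lemma to_peak_split:
  assumes "valley e p"
  obtains xs ys where "e = xs @ D # U # ys" "to_peak e p = xs @ U # D # ys" "length xs = p"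
proof -
  have p: "Suc p < length e" "e ! p = D" "e ! Suc p = U" using assms by (auto simp: valley_def)
  have e: "e = take p e @ D # U # drop (Suc (Suc p)) e"
    using p by (metis Cons_nth_drop_Suc Suc_lessD append_take_drop_id)
  have l: "length (take p e) = p" using p by simp
  have "to_peak e p = take p e @ U # D # drop (Suc (Suc p)) e"
    unfolding to_peak_def by (subst e) (use p in \<open>simp add: list_update_append min_def\<close>)
  with e l show ?thesis using that by blast
qed

text \<open>The up-step at \<open>Suc p\<close> overtakes one down-step; no other up-step is
  affected. The subtraction does not truncate, as the down-step at \<open>p\<close> precedes
  it.\<close>

lemma dbefore_to_peak:
  assumes "valley e p"
  shows "dbefore (to_peak e p) w =
    (if w = count_list (take (Suc p) e) U then dbefore e w - 1 else dbefore e w)"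
proof -
  obtain xs ys where *: "e = xs @ D # U # ys" "to_peak e p = xs @ U # D # ys" "length xs = p"
    using to_peak_split[OF assms] .
  show ?thesis unfolding *(2) using *(3)
    by (cases "w - count_list xs U") (auto simp: *(1) dbefore_append)
qed

lemma length_to_peak: "length (to_peak e p) = length e"
  by (simp add: to_peak_def)

lemma count_list_to_peak: "valley e p \<Longrightarrow> count_list (to_peak e p) s = count_list e s"
  by (erule to_peak_split) auto

section \<open>The bounce path\<close>

text \<open>
  Here \<open>t w\<close> and \<open>R w\<close> count the down-steps before the \<open>w\<close>-th up-step of \<open>d\<close> and of its bounce
  path. The fibres of \<open>R\<close> are the bounces, and \<open>R w\<close> is the smallest rank in the bounce of \<open>w\<close>.
\<close>

locale bounce_blocks =
  fixes n :: nat and t R :: "nat \<Rightarrow> nat"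
  assumes R_le: "w < n \<Longrightarrow> R w \<le> w"
    and R_R: "w < n \<Longrightarrow> R (R w) = R w"
    and t_le_R: "w < n \<Longrightarrow> t w \<le> R w"
    and R_eq_or_less: "w \<le> w' \<Longrightarrow> w' < n \<Longrightarrow> R w = R w' \<or> w < R w'"
    and R_less_t: "w < n \<Longrightarrow> w' < n \<Longrightarrow> R w < R w' \<Longrightarrow> R w < t w'"
    and t_mono: "w \<le> w' \<Longrightarrow> w' < n \<Longrightarrow> t w \<le> t w'"

text \<open>The points on the line of the ascent from \<open>(2 * r, 0)\<close> are those reached
  after exactly \<open>r\<close> down-steps, so this bounce meets \<open>d\<close> just before the
  down-step of rank \<open>r\<close>. The next bounce starts at rank \<open>r'\<close>, the number
  of up-steps of \<open>d\<close> before that point.\<close>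

lemma bounce_from_step:
  assumes d: "dyck_path n d" and r: "r < n"
  obtains r' where "r < r'" "r' \<le> n"
    "bounce_from d (2 * r) =
       replicate (r' - r) U @ replicate (r' - r) D @ bounce_from d (2 * r')"
    "\<And>w. w < r' \<Longrightarrow> dbefore d w \<le> r" "\<And>w. r' \<le> w \<Longrightarrow> w < n \<Longrightarrow> r < dbefore d w"
proof -
  have len: "length d = 2 * n" using d by (simp add: dyck_path_def)
  have cU: "count_list d U = n" using dyck_path_counts(2)[OF d] .
  have "r < count_list (take (2 * n) d) D" using count_list_U_D[of d] len cU r by simp
  from ex_step_of_rank[OF _ this] obtain P
    where P: "P < 2 * n" "d ! P = D" "count_list (take P d) D = r" using len by auto
  define r' where "r' = count_list (take P d) U"
  have Pr: "P = r + r'" using count_list_take_U_D[of P d] P len by (simp add: r'_def)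
  have "r < r'"
    using dyck_path_counts(1)[OF d, of "Suc P"] P len by (simp add: count_list_take_Suc r'_def)
  moreover have "r' \<le> n"
    using count_list_take_mono[of P "2 * n" d U] P len cU by (simp add: r'_def)
  moreover have hit: "bounce_hit d (2 * r) u \<longleftrightarrow> u = r' - r" for u
  proof
    assume u: "bounce_hit d (2 * r) u"
    let ?Q = "2 * r + u"
    \<comment> \<open>Abscissa \<open>2 * r + u\<close> and height \<open>u\<close> leave
      \<open>r\<close> down-steps, so the next step, a down-step, is the one of rank
      \<open>r\<close>.\<close>
    have "count_list (take ?Q d) D = r"
      using u count_list_take_U_D[of ?Q d] by (auto simp: bounce_hit_def height_def)
    then have "?Q = P"
      using count_list_take_less[of ?Q P d D] count_list_take_less[of P ?Q d D] u P len
      by (cases ?Q P rule: linorder_cases) (auto simp: bounce_hit_def)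
    then show "u = r' - r" using Pr by simp
  next
    assume "u = r' - r"
    then have "2 * r + u = P" using Pr \<open>r < r'\<close> by simp
    moreover have "height d P = int r' - int r" using P by (simp add: height_def r'_def)
    ultimately show "bounce_hit d (2 * r) u"
      using P(1,2) len \<open>r < r'\<close> \<open>u = _\<close> by (simp add: bounce_hit_def)
  qed
  have ex: "\<exists>u. bounce_hit d (2 * r) u" by (simp add: hit)
  have least: "(LEAST u. bounce_hit d (2 * r) u) = r' - r"
    by (rule Least_equality) (simp_all add: hit)
  have "bounce_from d (2 * r) =
       replicate (r' - r) U @ replicate (r' - r) D @ bounce_from d (2 * r')"
    using \<open>r < r'\<close> by (subst bounce_from.simps) (simp add: Let_def ex least diff_mult_distrib2)
  moreover have "dbefore d w \<le> r" if w: "w < r'" for w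
  proof -
    have wn: "w < count_list d U" using w \<open>r' \<le> n\<close> cU by simp
    have "dbefore d w + w < P" using dbefore_less_iff[OF wn] w by (simp add: r'_def)
    then show ?thesis
      using count_list_take_mono[of "dbefore d w + w" P d D] dbefore_nth(4)[OF wn] P by simp
  qed
  moreover have "r < dbefore d w" if w: "r' \<le> w" "w < n" for w
  proof -
    have wn: "w < count_list d U" using w cU by simp
    have "\<not> dbefore d w + w < P" using dbefore_less_iff[OF wn] w by (simp add: r'_def)
    moreover have "dbefore d w + w \<noteq> P" using dbefore_nth(2)[OF wn] P by auto
    ultimately have "P < dbefore d w + w" by simp
    from count_list_take_less[OF this, of d D] show ?thesis
      using dbefore_nth(4)[OF wn] P len by simp
  qed
  ultimately show ?thesis using that by blast
qed

text \<open>On the first bounce \<open>R r\<close> is constantly \<open>r\<close>; beyond it,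
  \<open>R r\<close> agrees with \<open>R r'\<close> for the next starting rank \<open>r'\<close>,
  to which the induction hypothesis applies. The shift by \<open>r\<close> lets the remaining
  bounces keep the ranks of the whole path.\<close>

lemma bounce_from_blocks:
  assumes d: "dyck_path n d" and "r \<le> n"
  defines "t \<equiv> dbefore d"
    and "R \<equiv> \<lambda>r w. r + dbefore (bounce_from d (2 * r)) (w - r)"
  shows "length (bounce_from d (2 * r)) = 2 * (n - r) \<and> count_list (bounce_from d (2 * r)) U = n - r
    \<and> (\<forall>w. r \<le> w \<and> w < n \<longrightarrow> r \<le> R r w \<and> R r w \<le> w \<and> R r (R r w) = R r w \<and> t w \<le> R r w)
    \<and> (\<forall>w w'. r \<le> w \<and> w \<le> w' \<and> w' < n \<longrightarrow> R r w = R r w' \<or> w < R r w')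
    \<and> (\<forall>w w'. r \<le> w \<and> w < n \<and> r \<le> w' \<and> w' < n \<and> R r w < R r w' \<longrightarrow> R r w < t w')"
  using \<open>r \<le> n\<close>
proof (induction "n - r" arbitrary: r rule: less_induct)
  case less
  show ?case
  proof (cases "r = n")
    case True
    have "length d = 2 * n" using d by (simp add: dyck_path_def)
    then have "\<nexists>u. bounce_hit d (2 * r) u" using True by (simp add: bounce_hit_def)
    then have "bounce_from d (2 * r) = []" by (subst bounce_from.simps) auto
    then show ?thesis using True by auto
  next
    case False
    then have "r < n" using less.prems by simp
    obtain r' where r': "r < r'" "r' \<le> n"
      and b: "bounce_from d (2 * r) =
         replicate (r' - r) U @ replicate (r' - r) D @ bounce_from d (2 * r')"
      and tl: "\<And>w. w < r' \<Longrightarrow> t w \<le> r" and tg: "\<And>w. r' \<le> w \<Longrightarrow> w < n \<Longrightarrow> r < t w"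
      using bounce_from_step[OF d \<open>r < n\<close>] unfolding t_def by metis
    have R1: "R r w = r" if "r \<le> w" "w < r'" for w
      using diff_less_mono[OF that(2,1)]
      by (simp add: R_def b dbefore_append dbefore_replicate_U count_list_replicate)
    have R2: "R r w = R r' w" if "r' \<le> w" for w
      using that r' by (simp add: R_def b dbefore_append count_list_replicate)
    note IH = less.hyps[of r', OF _ r'(2)]
    have "n - r' < n - r" using r' by simp
    note IH = IH[OF this]
    have len: "length (bounce_from d (2 * r)) = 2 * (n - r)"
      "count_list (bounce_from d (2 * r)) U = n - r"
      using IH r' by (simp_all add: b count_list_replicate)
    have IH1: "r' \<le> R r' w" "R r' w \<le> w" "R r' (R r' w) = R r' w" "t w \<le> R r' w"
      if "r' \<le> w" "w < n" for w
      using IH that by auto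
    have bounds: "r \<le> R r w \<and> R r w \<le> w \<and> R r (R r w) = R r w \<and> t w \<le> R r w" if "r \<le> w" "w < n" for w
    proof (cases "w < r'")
      case True
      then show ?thesis using R1 tl that r' by simp
    next
      case False
      then show ?thesis using R2 IH1[of w] that r' by simp
    qed
    have steps: "R r w = R r w' \<or> w < R r w'" if "r \<le> w" "w \<le> w'" "w' < n" for w w'
    proof -
      consider "w' < r'" | "w < r'" "r' \<le> w'" | "r' \<le> w" by linarith
      then show ?thesis
      proof cases
        case 1
        then show ?thesis using R1 that by simp
      next
        case 2
        then show ?thesis using R2[of w'] IH1(1)[of w'] that by simp
      next
        case 3
        then show ?thesis using R2 IH that by simp
      qed
    qed
    have gaps: "R r w < t w'" if "r \<le> w" "w < n" "r \<le> w'" "w' < n" "R r w < R r w'" for w w'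
    proof -
      consider "w' < r'" | "w < r'" "r' \<le> w'" | "r' \<le> w" "r' \<le> w'" by linarith
      then show ?thesis
      proof cases
        case 1
        then show ?thesis using R1 bounds[of w] that by simp
      next
        case 2
        then show ?thesis using R1 tg that by simp
      next
        case 3
        then show ?thesis using R2 IH that by simp
      qed
    qed
    show ?thesis using len bounds steps gaps by blast
  qed
qed

lemma bounce_blocks_bounce:
  assumes d: "dyck_path n d"
  shows "length (bounce d) = 2 * n" "count_list (bounce d) U = n"
    "bounce_blocks n (dbefore d) (dbefore (bounce d))"
proof -
  note * = bounce_from_blocks[OF d, of 0, simplified, folded bounce_def]
  show "length (bounce d) = 2 * n" "count_list (bounce d) U = n"
    using * by blast+
  show "bounce_blocks n (dbefore d) (dbefore (bounce d))"
    by unfold_locales (use * dbefore_mono[of _ _ d] dyck_path_counts(2)[OF d] in auto)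
qed

section \<open>The order of the labels\<close>

text \<open>\<open>relabel i j\<close> takes out the value \<open>i\<close>, closes the gap and
  reinserts it as \<open>j\<close>, so comparisons between other values persist.\<close>

lemma relabel_less: "x \<noteq> i \<Longrightarrow> y \<noteq> i \<Longrightarrow> x < y \<Longrightarrow> relabel i j x < relabel i j y"
  by (auto simp: relabel_def)

lemma relabel_bounds:
  assumes "i < j"
  shows "relabel i j i = j" "y \<noteq> i \<Longrightarrow> y \<le> j \<Longrightarrow> relabel i j y < j"
    "j < y \<Longrightarrow> relabel i j y = y"
  using assms by (auto simp: relabel_def)

lemma map_relabel_permutation:
  assumes \<sigma>: "\<sigma> \<in> permutations_of_set {1..n}" and ij: "i < j" "1 \<le> i" "j \<le> n"
  shows "map (relabel i j) \<sigma> \<in> permutations_of_set {1..n}"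
proof -
  have inj: "inj_on (relabel i j) {1..n}"
    using ij by (auto simp: inj_on_def relabel_def split: if_splits)
  have "relabel i j ` {1..n} \<subseteq> {1..n}" using ij by (auto simp: relabel_def)
  then have "relabel i j ` {1..n} = {1..n}" using inj by (intro endo_inj_surj) auto
  then show ?thesis using \<sigma> inj by (auto simp: permutations_of_set_def distinct_map)
qed

context bounce_blocks
begin

text \<open>A bounce that starts before that of \<open>w\<close> starts below \<open>t w\<close>, so
  none starts at a rank from \<open>t w\<close> to \<open>R w - 1\<close>. These are the ranks of
  the down-steps that the up-step of rank \<open>w\<close> passes; \<open>t w - 1\<close> is that of
  the last one remaining before it.\<close>

lemma R_const:
  assumes w: "w < n" "t w < R w" and x: "t w - 1 \<le> x" "x \<le> y" "y < R w"
  shows "R x = R y"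
proof (rule ccontr)
  assume "R x \<noteq> R y"
  have y: "y < n" using R_le[OF w(1)] w x by simp
  then have "x < R y" using R_eq_or_less[of x y] x \<open>R x \<noteq> R y\<close> by auto
  moreover have "R y < t w" using R_less_t[OF y w(1)] R_le[OF y] x by simp
  ultimately show False using x by simp
qed

text \<open>The up-step of rank \<open>w\<close> is not in the first bounce, so \<open>d\<close> has
  a down-step before it. This makes \<open>c w - 1\<close> in the invariant below a genuine
  rank.\<close>

lemma t_pos:
  assumes "w < n" "t w < R w" shows "0 < t w"
proof -
  have "R 0 = 0" using R_le[of 0] assms by simp
  then show ?thesis using R_less_t[of 0 w] assms by simp
qed

text \<open>\<open>c w\<close> counts the down-steps before the \<open>w\<close>-th up-step of the current path.\<close>

definition swap_invariant :: "(nat \<Rightarrow> nat) \<Rightarrow> nat list \<Rightarrow> bool" where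
  "swap_invariant c \<sigma> \<longleftrightarrow>
     \<sigma> \<in> permutations_of_set {1..n} \<and>
     (\<forall>w<n. t w \<le> c w \<and> c w \<le> R w) \<and>
     (\<forall>w w'. w < w' \<and> w' < n \<and> c w \<noteq> t w \<longrightarrow> c w' = R w') \<and>
     (\<forall>w w'. w < w' \<and> w' < n \<and> R w = R w' \<longrightarrow> \<sigma> ! w' < \<sigma> ! w) \<and>
     (\<forall>w<n. c w < R w \<longrightarrow> \<sigma> ! c w < \<sigma> ! w \<and> \<sigma> ! w < \<sigma> ! (c w - 1)) \<and>
     (\<forall>w<n. c w = R w \<longrightarrow> (\<forall>x<w. \<sigma> ! w < \<sigma> ! x))"

text \<open>The fourth fact expresses that up-steps are moved in order of rank. The last three place
  the label of an up-step relative to the nearest down-steps before and after it if it has been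
  moved, and below all labels of smaller rank if not.\<close>

lemma swap_invariantD:
  assumes "swap_invariant c \<sigma>"
  shows "\<sigma> \<in> permutations_of_set {1..n}"
    and "w < n \<Longrightarrow> t w \<le> c w" "w < n \<Longrightarrow> c w \<le> R w"
    and "w < w' \<Longrightarrow> w' < n \<Longrightarrow> c w \<noteq> t w \<Longrightarrow> c w' = R w'"
    and "w < w' \<Longrightarrow> w' < n \<Longrightarrow> R w = R w' \<Longrightarrow> \<sigma> ! w' < \<sigma> ! w"
    and "w < n \<Longrightarrow> c w < R w \<Longrightarrow> \<sigma> ! c w < \<sigma> ! w" "w < n \<Longrightarrow> c w < R w \<Longrightarrow> \<sigma> ! w < \<sigma> ! (c w - 1)"
    and "w < n \<Longrightarrow> c w = R w \<Longrightarrow> x < w \<Longrightarrow> \<sigma> ! w < \<sigma> ! x"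
  using assms unfolding swap_invariant_def by blast+

lemma swap_invariant_init: "swap_invariant R (decreasing_perm n)"
proof -
  have "decreasing_perm n ! w = n - w" if "w < n" for w
    using that by (simp add: decreasing_perm_def rev_nth del: upt_Suc)
  moreover have "decreasing_perm n \<in> permutations_of_set {1..n}"
    by (auto simp: decreasing_perm_def permutations_of_set_def simp del: upt_Suc)
  ultimately show ?thesis by (auto simp: swap_invariant_def t_le_R intro: diff_less_mono2)
qed

text \<open>\<open>u\<close> is the first up-step out of place and \<open>v\<close> the rank of the
  down-step it passes. Relative to the other labels only that of rank \<open>u\<close> moves, to
  just above that of rank \<open>v\<close>, so only comparisons with it need an argument.\<close>

lemma swap_invariant_step:
  assumes inv: "swap_invariant c \<sigma>" and u: "u < n" "t u < c u"
    and least: "\<And>w. w < u \<Longrightarrow> c w = t w"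
  defines "v \<equiv> c u - 1"
  shows "swap_invariant (c(u := v)) (map (relabel (min (\<sigma> ! v) (\<sigma> ! u)) (max (\<sigma> ! v) (\<sigma> ! u))) \<sigma>)"
proof -
  note I = swap_invariantD[OF inv]
  have v: "c u = Suc v" "t u \<le> v" using u by (auto simp: v_def)
  have vR: "v < R u" using I(3)[OF u(1)] v by simp
  have vu: "v < u" using vR R_le[OF u(1)] by simp
  have tR: "t u < R u" using v vR by simp
  have \<sigma>: "distinct \<sigma>" "set \<sigma> = {1..n}" "length \<sigma> = n"
    using I(1) by (auto simp: permutations_of_set_def dest: distinct_card)
  have less: "\<sigma> ! u < \<sigma> ! v"
  proof (cases "c u = R u")
    case True
    then show ?thesis using I(8)[OF u(1) _ vu] by simp
  next
    case False
    then show ?thesis using I(3)[OF u(1)] I(7)[OF u(1)] v by simp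
  qed
  define \<sigma>' where "\<sigma>' = map (relabel (\<sigma> ! u) (\<sigma> ! v)) \<sigma>"
  have rng: "\<sigma> ! x \<in> {1..n}" if "x < n" for x using that \<sigma> by (metis nth_mem)
  have perm: "\<sigma>' \<in> permutations_of_set {1..n}"
    unfolding \<sigma>'_def using less rng[of u] rng[of v] u vu
    by (intro map_relabel_permutation[OF I(1)]) auto
  have nth: "\<sigma>' ! x = relabel (\<sigma> ! u) (\<sigma> ! v) (\<sigma> ! x)" if "x < n" for x
    using that \<sigma> by (simp add: \<sigma>'_def)
  have ne: "\<sigma> ! x \<noteq> \<sigma> ! u" if "x < n" "x \<noteq> u" for x
    using that \<sigma> u by (simp add: nth_eq_iff_index_eq)
  have others: "\<sigma>' ! x < \<sigma>' ! y"
    if "x < n" "y < n" "x \<noteq> u" "y \<noteq> u" "\<sigma> ! x < \<sigma> ! y" for x y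
    using that ne nth by (simp add: relabel_less)
  have below: "\<sigma>' ! x < \<sigma>' ! u" if "x < n" "x \<noteq> u" "\<sigma> ! x \<le> \<sigma> ! v" for x
    using that ne nth u relabel_bounds[OF less] by simp
  have above: "\<sigma>' ! u < \<sigma>' ! y" if "y < n" "\<sigma> ! v < \<sigma> ! y" for y
    using that nth u relabel_bounds[OF less] by simp
  have later: "c w = R w" if "u < w" "w < n" for w
    using I(4)[OF that] u by simp
  have blocks: "\<sigma>' ! w' < \<sigma>' ! w" if ww: "w < w'" "w' < n" "R w = R w'" for w w'
  proof -
    have old: "\<sigma> ! w' < \<sigma> ! w" using I(5)[OF ww] .
    consider "w = u" | "w' = u" | "w \<noteq> u" "w' \<noteq> u" by blast
    then show ?thesis
    proof cases
      case 1
      then show ?thesis using below[of w'] old less ww by simp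
    next
      case 2
      \<comment> \<open>This up-step is in its final place. The ranks from \<open>c w\<close> to
        \<open>v\<close> lie in one bounce, so
        \<open>\<sigma> ! v \<le> \<sigma> ! c w < \<sigma> ! w\<close>, and the lifted label stays
        below that of \<open>w\<close>.\<close>
      have w: "w < u" "c w = t w" using ww least 2 by auto
      have "t w \<le> t u" using t_mono w u by simp
      then have cw: "c w \<le> v" using w v by simp
      have "t w < R w" using cw w vR ww 2 by simp
      then have "R (c w) = R v"
        using R_const[of w "c w" v] w u cw vR ww 2 by simp
      then have "\<sigma> ! v \<le> \<sigma> ! c w"
        using I(5)[of "c w" v] cw vu u by (cases "c w = v") auto
      also have "\<sigma> ! c w < \<sigma> ! w" using I(6)[of w] \<open>t w < R w\<close> w u by simp
      finally show ?thesis using above[of w] w u 2 by simp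
    next
      case 3
      then show ?thesis using others old ww by simp
    qed
  qed
  have moved: "\<sigma>' ! (c(u := v)) w < \<sigma>' ! w \<and> \<sigma>' ! w < \<sigma>' ! ((c(u := v)) w - 1)"
    if w: "w < n" "(c(u := v)) w < R w" for w
  proof (cases "w = u")
    case True
    \<comment> \<open>\<open>v - 1\<close> can be as small as \<open>t u - 1\<close>, the lowest
      rank covered by \<open>R_const\<close>. It shares a bounce with \<open>v\<close>, so its label
      is above that of \<open>v\<close>, and hence above the lifted one.\<close>
    have "0 < t u" using t_pos[OF u(1) tR] .
    then have "R (v - 1) = R v" using R_const[OF u(1) tR, of "v - 1" v] v vR by simp
    then have "\<sigma> ! v < \<sigma> ! (v - 1)"
      using I(5)[of "v - 1" v] vu u v \<open>0 < t u\<close> by simp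
    then show ?thesis using above[of "v - 1"] below[of v] vu u True by simp
  next
    case False
    then have cw: "c w < R w" using w by simp
    then have "w < u" using later[of w] w False by (cases w u rule: linorder_cases) auto
    moreover have "c w < w" using cw R_le[OF w(1)] by simp
    ultimately show ?thesis using False others I(6,7)[OF w(1) cw] u by simp
  qed
  have unmoved: "\<sigma>' ! w < \<sigma>' ! x" if w: "w < n" "(c(u := v)) w = R w" "x < w" for w x
  proof -
    have "w \<noteq> u" using w vR by auto
    then have old: "\<sigma> ! w < \<sigma> ! x" using I(8)[of w x] w by simp
    show ?thesis
    proof (cases "x = u")
      case True
      then show ?thesis using below[of w] \<open>w \<noteq> u\<close> old less w by simp
    next
      case False
      then show ?thesis using others old w \<open>w \<noteq> u\<close> by simp
    qed
  qed
  have "swap_invariant (c(u := v)) \<sigma>'"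
    unfolding swap_invariant_def
  proof (intro conjI allI impI; (elim conjE)?)
    fix w w' assume *: "w < w'" "w' < n" "(c(u := v)) w \<noteq> t w"
    then have "u \<le> w" using least[of w] by (cases "w < u") auto
    then show "(c(u := v)) w' = R w'" using later[of w'] * by simp
  qed (use perm blocks moved unmoved I(2,3) v vR in \<open>auto split: if_splits\<close>)
  then show ?thesis using less by (simp add: \<sigma>'_def min_def max_def)
qed

end

section \<open>Counting descents\<close>

lemma less_of_Suc_less:
  fixes f :: "nat \<Rightarrow> 'a::order"
  assumes "p < q" "\<And>i. p \<le> i \<Longrightarrow> i < q \<Longrightarrow> f (Suc i) < f i"
  shows "f q < f p"
  using assms
proof (induction q)
  case (Suc q)
  show ?case
  proof (cases "p = q")
    case True
    then show ?thesis using Suc.prems(2)[of q] by simp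
  next
    case False
    then have "f q < f p" using Suc by simp
    with Suc.prems(2)[of q] Suc.prems(1) show ?thesis by (meson lessI less_Suc_eq_le less_trans)
  qed
qed simp

text \<open>Equality is included, since the two steps of a peak may carry the same label.\<close>

definition nondescents :: "lstep list \<Rightarrow> nat list \<Rightarrow> nat set" where
  "nondescents d \<sigma> = {j. Suc j < length d \<and> can d \<sigma> ! j \<le> can d \<sigma> ! Suc j}"

lemma finite_nondescents: "finite (nondescents d \<sigma>)"
  by (rule finite_subset[of _ "{..<length d}"]) (auto simp: nondescents_def)

lemma des_eq: "des d \<sigma> = (length d - 1) - card (nondescents d \<sigma>)"
proof -
  have "{j. Suc j < length (can d \<sigma>) \<and> can d \<sigma> ! j > can d \<sigma> ! Suc j}
      = {..<length d - 1} - nondescents d \<sigma>"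
    by (auto simp: nondescents_def)
  moreover have "nondescents d \<sigma> \<subseteq> {..<length d - 1}" by (auto simp: nondescents_def)
  ultimately show ?thesis
    using finite_nondescents by (simp add: des_def card_Diff_subset)
qed

text \<open>The fixed points of \<open>R\<close> are the first ranks of the bounces. If
  \<open>R\<close> comes from the bounce path of \<open>d\<close>, then \<open>Suc j\<close> is the
  abscissa where a bounce meets \<open>d\<close>; \<open>j\<close> is the index of the pair of
  adjacent labels in question.\<close>

definition bounce_ends :: "lstep list \<Rightarrow> (nat \<Rightarrow> nat) \<Rightarrow> nat set" where
  "bounce_ends d R = {j. Suc j < length d \<and> d ! Suc j = D \<and>
     R (count_list (take (Suc j) d) D) = count_list (take (Suc j) d) D}"

lemma card_bounce_ends_le:
  assumes d: "dyck_path n d" and "bounce_blocks n (dbefore d) R"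
  shows "card (bounce_ends d R) \<le> card (nondescents d \<sigma>)"
proof -
  interpret bounce_blocks n "dbefore d" R by fact
  have len: "length d = 2 * n" using d by (simp add: dyck_path_def)
  have cU: "count_list d U = n" using dyck_path_counts(2)[OF d] .
  have cD: "count_list d D = n" using count_list_U_D[of d] len cU by simp
  define rk where "rk j = count_list (take (Suc j) d) D" for j
  \<comment> \<open>The position of the up-step with the same rank, hence the same label, as the
    down-step at \<open>Suc j\<close>.\<close>
  define q where "q j = dbefore d (rk j) + rk j" for j
  have B: "Suc j < length d" "d ! Suc j = D" "R (rk j) = rk j" "rk j < n"
    if "j \<in> bounce_ends d R" for j
    using that count_list_take_less[of "Suc j" "length d" d D] cD
    by (auto simp: bounce_ends_def rk_def)
  have "\<exists>i\<in>nondescents d \<sigma>. q j \<le> i \<and> i \<le> j" if j: "j \<in> bounce_ends d R" for j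
  proof (rule ccontr)
    assume no: "\<not> ?thesis"
    note Bj = B[OF j]
    have w: "rk j < count_list d U" using Bj cU by simp
    note qj = dbefore_nth[OF w, folded q_def]
    have "q j \<noteq> Suc j" using qj Bj by auto
    \<comment> \<open>By \<open>t_le_R\<close> at a fixed point of \<open>R\<close>, at most
      \<open>rk j\<close> down-steps precede this up-step; after \<open>Suc j\<close> there would be
      more.\<close>
    moreover have "\<not> Suc j < q j"
      using count_list_take_less[of "Suc j" "q j" d D] Bj qj t_le_R[of "rk j"]
      by (auto simp: rk_def)
    ultimately have "q j < Suc j" by simp
    then have "can d \<sigma> ! Suc j < can d \<sigma> ! q j"
    proof (rule less_of_Suc_less)
      fix i assume "q j \<le> i" "i < Suc j"
      then show "can d \<sigma> ! Suc i < can d \<sigma> ! i"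
        using no Bj(1) by (force simp: nondescents_def)
    qed
    moreover have "can d \<sigma> ! Suc j = can d \<sigma> ! q j"
      using Bj qj by (simp add: can_nth rk_def)
    ultimately show False by simp
  qed
  then obtain f where f: "\<And>j. j \<in> bounce_ends d R \<Longrightarrow> f j \<in> nondescents d \<sigma> \<and> q j \<le> f j \<and> f j \<le> j"
    by metis
  have less: "f j < f j'" if jj: "j \<in> bounce_ends d R" "j' \<in> bounce_ends d R" "j < j'" for j j'
  proof -
    note Bj = B[OF jj(1)] and Bj' = B[OF jj(2)]
    have "rk j < rk j'"
      using count_list_take_less[of "Suc j" "Suc j'" d D] Bj jj by (simp add: rk_def)
    \<comment> \<open>More than \<open>rk j\<close> down-steps precede the up-step at
      \<open>q j'\<close>, so it comes after \<open>Suc j\<close> and the two stretches are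
      disjoint.\<close>
    then have *: "rk j < dbefore d (rk j')" using R_less_t[of "rk j" "rk j'"] Bj Bj' by simp
    have "\<not> q j' \<le> Suc j"
      using count_list_take_mono[of "q j'" "Suc j" d D] dbefore_nth(4)[of "rk j'" d] * Bj' cU
      by (auto simp: q_def rk_def)
    then show ?thesis using f[OF jj(1)] f[OF jj(2)] by simp
  qed
  have "inj_on f (bounce_ends d R)"
    by (rule linorder_inj_onI') (use less in fastforce)
  then show ?thesis
    using f finite_nondescents by (intro card_inj_on_le[of f]) auto
qed

lemma (in bounce_blocks) nondescents_subset_bounce_ends:
  assumes d: "dyck_path n d" and t: "t = dbefore d" and inv: "swap_invariant t \<tau>"
  shows "nondescents d \<tau> \<subseteq> bounce_ends d R"
proof
  fix j assume j: "j \<in> nondescents d \<tau>"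
  note I = swap_invariantD[OF inv]
  have len: "length d = 2 * n" using d by (simp add: dyck_path_def)
  have cU: "count_list d U = n" using dyck_path_counts(2)[OF d] .
  have cD: "count_list d D = n" using count_list_U_D[of d] len cU by simp
  have Sj: "Suc j < length d" and asc: "can d \<tau> ! j \<le> can d \<tau> ! Suc j"
    using j by (auto simp: nondescents_def)
  define w where "w = count_list (take j d) U"
  define v where "v = count_list (take j d) D"
  have cS: "count_list (take (Suc j) d) U = (if d ! j = U then Suc w else w)"
    "count_list (take (Suc j) d) D = (if d ! j = D then Suc v else v)"
    using Sj by (simp_all add: w_def v_def count_list_take_Suc)
  have ltn: "count_list (take i d) (d ! i) < n" if "i < length d" for i
    using count_list_take_less[OF that that refl] cU cD by (cases "d ! i") auto
  have canj: "can d \<tau> ! j = \<tau> ! (if d ! j = U then w else v)"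
    using Sj by (cases "d ! j") (simp_all add: can_nth w_def v_def)
  have canSj: "can d \<tau> ! Suc j = \<tau> ! count_list (take (Suc j) d) (d ! Suc j)"
    using Sj by (simp add: can_nth)
  have tj: "t w = v" if "d ! j = U"
    using dbefore_count_take[of j d] that Sj by (simp add: t w_def v_def)
  have tSj: "t (count_list (take (Suc j) d) U) = count_list (take (Suc j) d) D" if "d ! Suc j = U"
    using dbefore_count_take[of "Suc j" d] that Sj by (simp add: t)
  have lj: "(if d ! j = U then w else v) < n"
    using ltn[of j] Sj by (cases "d ! j") (simp_all add: w_def v_def)
  have lSj: "count_list (take (Suc j) d) (d ! Suc j) < n"
    using ltn[of "Suc j"] Sj by simp
  show "j \<in> bounce_ends d R"
  proof (cases "d ! j"; cases "d ! Suc j")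
    assume *: "d ! j = U" "d ! Suc j = U"
    then have wn: "Suc w < n" and eq: "t (Suc w) = t w" using lSj cS tj tSj by auto
    \<comment> \<open>No down-step lies between these up-steps, whereas up-steps of different
      bounces are separated by one.\<close>
    have "R w = R (Suc w)"
    proof (rule ccontr)
      assume ne: "R w \<noteq> R (Suc w)"
      then have "R w < R (Suc w)" using R_eq_or_less[of w "Suc w"] R_le[of w] wn by auto
      then have "R w < t (Suc w)" using R_less_t[of w "Suc w"] wn by simp
      then show False using t_le_R[of w] eq wn by simp
    qed
    then have "\<tau> ! Suc w < \<tau> ! w" using I(5)[of w "Suc w"] wn by simp
    then show ?thesis using asc canj canSj cS * by simp
  next
    assume *: "d ! j = D" "d ! Suc j = D"
    then have vn: "Suc v < n" using lSj cS by auto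
    have "R v \<noteq> R (Suc v)" using I(5)[of v "Suc v"] vn asc canj canSj cS * by auto
    then have "R (Suc v) = Suc v" using R_eq_or_less[of v "Suc v"] R_le[of "Suc v"] vn by auto
    then show ?thesis using Sj * cS by (simp add: bounce_ends_def)
  next
    assume *: "d ! j = D" "d ! Suc j = U"
    then have wn: "w < n" and tw: "t w = Suc v" using lSj cS tSj by auto
    \<comment> \<open>The down-step in front of the up-step has rank \<open>t w - 1\<close>; its
      label is larger whether or not the up-step has been moved.\<close>
    have "\<tau> ! w < \<tau> ! v"
    proof (cases "t w = R w")
      case True
      then show ?thesis using I(8)[of w v] wn tw R_le[of w] by simp
    next
      case False
      then show ?thesis using I(7)[of w] wn tw t_le_R[of w] by simp
    qed
    then show ?thesis using asc canj canSj cS * by simp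
  next
    assume *: "d ! j = U" "d ! Suc j = D"
    then have wn: "w < n" and tw: "t w = v" using lj tj by auto
    \<comment> \<open>A moved up-step would have a larger label than the down-step of rank
      \<open>t w\<close> after it. So \<open>t w = R w\<close>, and this down-step has the first
      rank of a bounce.\<close>
    have "\<not> t w < R w" using I(6)[of w] wn tw asc canj canSj cS * by auto
    then have "R v = v" using t_le_R[of w] R_R[of w] wn tw by simp
    then show ?thesis using Sj * cS by (simp add: bounce_ends_def)
  qed
qed

section \<open>The procedure\<close>

text \<open>The first up-step that is later than in \<open>d\<close> forms the leftmost admissible
  valley. Swapping there lowers one term of the sum, which thus serves as termination
  measure.\<close>

lemma (in bounce_blocks) swap_leftmost_step:
  assumes d: "dyck_path n d" and t: "t = dbefore d"
    and e: "length e = 2 * n" "count_list e U = n" and inv: "swap_invariant (dbefore e) \<sigma>"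
    and "e \<noteq> d"
  obtains e' \<sigma>' where "swap_leftmost n d (e, \<sigma>) = Some (e', \<sigma>')"
    "length e' = 2 * n" "count_list e' U = n" "swap_invariant (dbefore e') \<sigma>'"
    "(\<Sum>w<n. dbefore e' w) < (\<Sum>w<n. dbefore e w)"
proof -
  note I = swap_invariantD[OF inv]
  have len: "length d = 2 * n" using d by (simp add: dyck_path_def)
  have cU: "count_list d U = n" using dyck_path_counts(2)[OF d] .
  have "\<exists>w. w < n \<and> dbefore e w \<noteq> t w"
  proof (rule ccontr)
    assume "\<not> ?thesis"
    then have "under e d" "under d e"
      using under_iff_dbefore[of e d n] under_iff_dbefore[of d e n] e len cU t by auto
    then show False using under_antisym \<open>e \<noteq> d\<close> by blast
  qed
  then obtain u where u: "u < n" "dbefore e u \<noteq> t u"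
    and least: "\<And>w. w < u \<Longrightarrow> dbefore e w = t w"
    using exists_least_iff[of "\<lambda>w. w < n \<and> dbefore e w \<noteq> t w"] by (meson less_trans)
  have tu: "t u < dbefore e u" using u I(2)[OF u(1)] by simp
  define v where "v = dbefore e u - 1"
  define p where "p = v + u"
  have v: "dbefore e u = Suc v" using tu by (simp add: v_def)
  have uc: "u < count_list e U" using u e by simp
  have pos: "dbefore e u + u = Suc p" using v by (simp add: p_def)
  note P = dbefore_nth[OF uc, unfolded pos]
  \<comment> \<open>An up-step at \<open>p\<close> would have rank \<open>u - 1\<close> and be in
    place already, with as many down-steps before it as \<open>u\<close>; but then
    \<open>t (u - 1) > t u\<close>.\<close>
  have "e ! p = D"
  proof (rule ccontr)
    assume "e ! p \<noteq> D"
    then have pU: "e ! p = U" by (metis lstep.exhaust)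
    then have c: "u = Suc (count_list (take p e) U)" "count_list (take p e) D = Suc v"
      using P v by (simp_all add: count_list_take_Suc)
    then have "dbefore e (u - 1) = Suc v"
      using dbefore_count_take[of p e] pU P(1) by simp
    then have "t (u - 1) = Suc v" using least[of "u - 1"] c by simp
    moreover have "t (u - 1) \<le> t u" using t_mono u by simp
    ultimately show False using tu v by simp
  qed
  then have val: "valley e p" using P by (simp add: valley_def)
  have cp: "count_list (take p e) D = v"
    using P v \<open>e ! p = D\<close> by (simp add: count_list_take_Suc)
  have db: "dbefore (to_peak e p) = (dbefore e)(u := v)"
    using dbefore_to_peak[OF val] P v by (auto simp: fun_eq_iff)
  define e' where "e' = to_peak e p"
  have len': "length e' = 2 * n" using e by (simp add: e'_def length_to_peak)
  have cU': "count_list e' U = n" using e by (simp add: e'_def count_list_to_peak[OF val])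
  have sw: "swappable n d e p"
  proof -
    have "dbefore e' w \<le> w" if "w < n" for w
      using I(3)[OF that] R_le[OF that] v by (auto simp: e'_def db)
    then have "dyck_path n e'" using dyck_pathI_dbefore len' cU' by blast
    moreover have "under e' d"
      using under_iff_dbefore[of e' d n] len' len cU' cU I(2) tu v by (auto simp: e'_def db t)
    ultimately show ?thesis using val by (simp add: swappable_def e'_def)
  qed
  \<comment> \<open>A valley further left has an up-step of rank \<open>w < u\<close>, which is in
    its place in \<open>d\<close>; moving it ahead of a down-step would take the path above
    \<open>d\<close>.\<close>
  have "p \<le> p'" if sw': "swappable n d e p'" for p'
  proof (rule ccontr)
    assume "\<not> p \<le> p'"
    have val': "valley e p'" and under': "under (to_peak e p') d"
      using sw' by (auto simp: swappable_def)
    then have p': "Suc p' < length e" "e ! p' = D" "e ! Suc p' = U" by (auto simp: valley_def)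
    define w where "w = count_list (take (Suc p') e) U"
    have "w < u"
      using count_list_take_less[of "Suc p'" "Suc p" e U] p' P \<open>\<not> p \<le> p'\<close> by (simp add: w_def)
    have "0 < dbefore e w"
      using dbefore_count_take[of "Suc p'" e] p' by (simp add: w_def count_list_take_Suc)
    moreover have "dbefore d w \<le> dbefore (to_peak e p') w"
      using under_iff_dbefore[of "to_peak e p'" d n] under' len e cU u \<open>w < u\<close>
      by (simp add: count_list_to_peak[OF val'] length_to_peak)
    ultimately show False
      using dbefore_to_peak[OF val', of w] least[OF \<open>w < u\<close>] by (simp add: w_def t)
  qed
  then have "(LEAST p. swappable n d e p) = p" using sw by (intro Least_equality)
  moreover have "can e \<sigma> ! p = \<sigma> ! v" "can e \<sigma> ! Suc p = \<sigma> ! u"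
    using P \<open>e ! p = D\<close> cp by (simp_all add: can_nth)
  moreover define \<sigma>' where
    "\<sigma>' = map (relabel (min (\<sigma> ! v) (\<sigma> ! u)) (max (\<sigma> ! v) (\<sigma> ! u))) \<sigma>"
  ultimately have "swap_leftmost n d (e, \<sigma>) = Some (e', \<sigma>')"
    using sw by (auto simp: swap_leftmost_def valley_swap_def e'_def Let_def)
  moreover have "swap_invariant (dbefore e') \<sigma>'"
    using swap_invariant_step[OF inv u(1) tu least] by (simp add: e'_def \<sigma>'_def db v_def)
  moreover have "(\<Sum>w<n. dbefore e' w) < (\<Sum>w<n. dbefore e w)"
    using u v by (intro sum_strict_mono_ex1) (auto simp: e'_def db)
  ultimately show ?thesis using that len' cU' by blast
qed

lemma valley_procedure_result:
  assumes d: "dyck_path n d"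
  obtains \<tau> where "valley_procedure n d = Some (Some (d, \<tau>))"
    "bounce_blocks.swap_invariant n (dbefore d) (dbefore (bounce d)) (dbefore d) \<tau>"
proof -
  note b = bounce_blocks_bounce[OF d]
  interpret bounce_blocks n "dbefore d" "dbefore (bounce d)" by (rule b(3))
  \<comment> \<open>Requiring a state of the form \<open>Some (e, \<sigma>)\<close> expresses that
    the procedure never gets stuck.\<close>
  define P where "P s = (\<exists>e \<sigma>. s = Some (e, \<sigma>) \<and> length e = 2 * n \<and> count_list e U = n
    \<and> swap_invariant (dbefore e) \<sigma>)" for s :: "canon option"
  define m where "m s = (\<Sum>w<n. dbefore (fst (the s)) w)" for s :: "canon option"
  let ?b = "\<lambda>s :: canon option. case s of None \<Rightarrow> False | Some c \<Rightarrow> fst c \<noteq> d"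
  let ?c = "\<lambda>s. Option.bind s (swap_leftmost n d)"
  have step: "P (?c s) \<and> m (?c s) < m s" if P: "P s" and b: "?b s" for s
  proof -
    from P obtain e \<sigma> where s: "s = Some (e, \<sigma>)" "length e = 2 * n" "count_list e U = n"
      "swap_invariant (dbefore e) \<sigma>" by (auto simp: P_def)
    then have "e \<noteq> d" using b by simp
    from swap_leftmost_step[OF d refl s(2-4) this] show ?thesis
      unfolding P_def m_def s(1) by (metis bind.bind_lunit fst_conv option.sel)
  qed
  let ?s = "Some (bounce d, decreasing_perm n)"
  have P0: "P ?s" using b swap_invariant_init by (simp add: P_def)
  obtain s where s: "while_option ?b ?c ?s = Some s"
    using measure_while_option_Some[of P ?b ?c m, OF step P0] by blast
  have "P s" using while_option_rule[of P ?b ?c, OF _ s P0] step by blast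
  moreover have "\<not> ?b s" using while_option_stop[OF s] .
  ultimately obtain \<tau> where "s = Some (d, \<tau>)" "swap_invariant (dbefore d) \<tau>"
    by (auto simp: P_def)
  then show ?thesis using that s by (simp add: valley_procedure_def)
qed

theorem theorem5p5:
  fixes n :: nat and d :: "lstep list"
  assumes "dyck_path n d"
  shows "valley_procedure n d = Some (Some (d, vperm n d)) \<and> vperm n d \<in> max_des_perms n d"
proof -
  note b = bounce_blocks_bounce(3)[OF assms]
  interpret bounce_blocks n "dbefore d" "dbefore (bounce d)" by (rule b)
  obtain \<tau> where proc: "valley_procedure n d = Some (Some (d, \<tau>))"
    and inv: "swap_invariant (dbefore d) \<tau>"
    using valley_procedure_result[OF assms] .
  have \<tau>: "vperm n d = \<tau>" using proc by (simp add: vperm_def)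
  have perm: "\<tau> \<in> permutations_of_set {1..n}" using swap_invariantD(1)[OF inv] .
  have "finite (bounce_ends d (dbefore (bounce d)))"
    by (rule finite_subset[of _ "{..<length d}"]) (auto simp: bounce_ends_def)
  then have "card (nondescents d \<tau>) \<le> card (bounce_ends d (dbefore (bounce d)))"
    using nondescents_subset_bounce_ends[OF assms refl inv] by (rule card_mono)
  \<comment> \<open>\<open>bounce_ends\<close> is independent of the labelling, so it mediates
    between \<open>\<tau>\<close> and an arbitrary \<open>\<sigma>\<close>.\<close>
  then have "card (nondescents d \<tau>) \<le> card (nondescents d \<sigma>)" for \<sigma>
    using card_bounce_ends_le[OF assms b] by (rule le_trans)
  then have "des d \<sigma> \<le> des d \<tau>" for \<sigma> by (simp add: des_eq diff_le_mono2)
  then have "max_des n d = des d \<tau>"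
    unfolding max_des_def using perm by (intro Max_eqI) auto
  then show ?thesis using proc perm by (simp add: \<tau> max_des_perms_def)
qed

end
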